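(* Let $\mathcal V$ be a finite set of states, $E:\mathcal V\to\mathbb R$ an energy function, and $w$ a real antisymmetric function on edges, $w(x,y)=-w(y,x)$, with $E$ and $w$ not depending on the inverse temperature $\beta$. For every $\beta\in(0,\infty)$ let $k_{\mathrm{eq}}(x,y)=k_{\mathrm{eq}}^{(\beta)}(x,y)\ge 0$ be transition rates, irreducible on a fixed connected graph with vertex set $\mathcal V$, satisfying detailed balance with respect to $\rho_{\mathrm{eq}}(x)\propto e^{-\beta E(x)}$. Let $\varepsilon$ be a fixed real number not depending on $\beta$. Then the McLennan quasipotential $$V_{\mathrm{ML}}(x)=E(x)-\langle E\rangle_{\mathrm{ML}}+W(x),\qquad x\in\mathcal V,$$ is uniformly bounded in temperature: there is a constant $K<\infty$, not depending on $\beta$, such that $|V_{\mathrm{ML}}(x)|\le K$ for all $x\in\mathcal V$ and all $\beta\in(0,\infty)$.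
   Context: Edges of the graph: the fixed graph has edge set $\mathcal E$ (independent of $\beta$), and $\{x,y\}\in\mathcal E$ if and only if $k_{\mathrm{eq}}(x,y)>0$ (equivalently $k_{\mathrm{eq}}(y,x)>0$, by detailed balance). Detailed balance means $k_{\mathrm{eq}}(x,y)\rho_{\mathrm{eq}}(x)=k_{\mathrm{eq}}(y,x)\rho_{\mathrm{eq}}(y)$ for all $x,y$, with $\rho_{\mathrm{eq}}(x)=e^{-\beta E(x)}/\sum_{y}e^{-\beta E(y)}$. The equilibrium backward generator is $L_{\mathrm{eq}}f(x)=\sum_y k_{\mathrm{eq}}(x,y)[f(y)-f(x)]$, and $\langle f\rangle_{\mathrm{eq}}=\sum_x f(x)\rho_{\mathrm{eq}}(x)$. $W$ (depending on $\beta$ and $\varepsilon$) is the unique solution of the Poisson equation $$L_{\mathrm{eq}}W(x)=-\varepsilon\sum_y k_{\mathrm{eq}}(x,y)\,w(x,y)\quad\text{for all }x,\qquad \langle W\rangle_{\mathrm{eq}}=0 .$$ The McLennan distribution is $\rho_{\mathrm{ML}}(x)=\rho_{\mathrm{eq}}(x)\,(1-\beta W(x))$, which is normalized (for a given $\beta$ it is positive when $\varepsilon\beta w$ is small enough, but positivity is not needed here), and $\langle f\rangle_{\mathrm{ML}}=\sum_x f(x)\rho_{\mathrm{ML}}(x)$. In particular $\langle E\rangle_{\mathrm{ML}}=\langle E\rangle_{\mathrm{eq}}-\beta\langle EW\rangle_{\mathrm{eq}}$. *)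

theory Defs
  imports Complex_Main
begin

(* States are the elements of a finite (hence nonempty) type. An undirected graph on them is
   given by its set of edges {x, y}; loops {x, x} = {x} are permitted. *)

definition connected_graph :: "'v set set \<Rightarrow> bool" where
  "connected_graph Edges \<longleftrightarrow>
     (\<forall>e\<in>Edges. \<exists>x y. e = {x, y}) \<and> (\<forall>x y. (x, y) \<in> {(u, v). {u, v} \<in> Edges}\<^sup>*)"

definition irreducible_rates :: "('v \<Rightarrow> 'v \<Rightarrow> real) \<Rightarrow> bool" where
  "irreducible_rates k \<longleftrightarrow> (\<forall>x y. (x, y) \<in> {(u, v). 0 < k u v}\<^sup>*)"

definition rho_eq :: "real \<Rightarrow> ('v::finite \<Rightarrow> real) \<Rightarrow> 'v \<Rightarrow> real" where
  "rho_eq \<beta> E x = exp (- \<beta> * E x) / (\<Sum>y\<in>UNIV. exp (- \<beta> * E y))"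

definition detailed_balance :: "('v \<Rightarrow> 'v \<Rightarrow> real) \<Rightarrow> ('v \<Rightarrow> real) \<Rightarrow> bool" where
  "detailed_balance k \<rho> \<longleftrightarrow> (\<forall>x y. k x y * \<rho> x = k y x * \<rho> y)"

definition mean :: "('v::finite \<Rightarrow> real) \<Rightarrow> ('v \<Rightarrow> real) \<Rightarrow> real" where
  "mean \<rho> f = (\<Sum>x\<in>UNIV. f x * \<rho> x)"

definition generator :: "('v::finite \<Rightarrow> 'v \<Rightarrow> real) \<Rightarrow> ('v \<Rightarrow> real) \<Rightarrow> 'v \<Rightarrow> real" where
  "generator k f x = (\<Sum>y\<in>UNIV. k x y * (f y - f x))"

definition poisson_solution ::
  "real \<Rightarrow> ('v::finite \<Rightarrow> real) \<Rightarrow> ('v \<Rightarrow> 'v \<Rightarrow> real) \<Rightarrow> ('v \<Rightarrow> 'v \<Rightarrow> real) \<Rightarrow> real \<Rightarrow> ('v \<Rightarrow> real) \<Rightarrow> bool" where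
  "poisson_solution \<beta> E k w \<epsilon> W \<longleftrightarrow>
     (\<forall>x. generator k W x = - \<epsilon> * (\<Sum>y\<in>UNIV. k x y * w x y)) \<and> mean (rho_eq \<beta> E) W = 0"

(* For irreducible rates in detailed balance with rho_eq, and w antisymmetric on the edges, the
   Poisson equation has exactly one solution; elsewhere this is an unspecified function. *)
definition W_ML ::
  "real \<Rightarrow> ('v::finite \<Rightarrow> real) \<Rightarrow> ('v \<Rightarrow> 'v \<Rightarrow> real) \<Rightarrow> ('v \<Rightarrow> 'v \<Rightarrow> real) \<Rightarrow> real \<Rightarrow> 'v \<Rightarrow> real" where
  "W_ML \<beta> E k w \<epsilon> = (THE W. poisson_solution \<beta> E k w \<epsilon> W)"

definition rho_ML ::
  "real \<Rightarrow> ('v::finite \<Rightarrow> real) \<Rightarrow> ('v \<Rightarrow> 'v \<Rightarrow> real) \<Rightarrow> ('v \<Rightarrow> 'v \<Rightarrow> real) \<Rightarrow> real \<Rightarrow> 'v \<Rightarrow> real" where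
  "rho_ML \<beta> E k w \<epsilon> x = rho_eq \<beta> E x * (1 - \<beta> * W_ML \<beta> E k w \<epsilon> x)"

definition V_ML ::
  "real \<Rightarrow> ('v::finite \<Rightarrow> real) \<Rightarrow> ('v \<Rightarrow> 'v \<Rightarrow> real) \<Rightarrow> ('v \<Rightarrow> 'v \<Rightarrow> real) \<Rightarrow> real \<Rightarrow> 'v \<Rightarrow> real" where
  "V_ML \<beta> E k w \<epsilon> x = E x - mean (rho_ML \<beta> E k w \<epsilon>) E + W_ML \<beta> E k w \<epsilon> x"

end

(* Write c x y = rho_eq x * k x y, which is symmetric by detailed balance. The Poisson equation says
   that the antisymmetric current c x y * (W y - W x + \<epsilon> * w x y) is divergence-free, so its flux
   through every cut vanishes. If the values of W had a gap larger than M = |\<epsilon>| max |w|, then across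
   the cut at that gap every current would have the same strict sign, which is absurd. So the
   oscillation of W is at most M times the number of states, whatever the rates are. With M = 0 this
   is uniqueness for the Poisson equation, and existence follows by linear algebra. Finally
   \<beta> <E W>_eq = \<beta> <(E - min E) W>_eq because <W>_eq = 0, and this stays bounded since t exp (- t) \<le> 1. *)

theory Submission
  imports Defs "HOL-Analysis.Cartesian_Space"
begin

section \<open>Cuts and antisymmetric currents\<close>

lemma irreducible_rates_cut:
  assumes "irreducible_rates k" "x \<in> S" "y \<notin> S"
  shows "\<exists>u\<in>S. \<exists>v\<in>- S. 0 < k u v"
proof (rule ccontr)
  assume no: "\<not> ?thesis"
  have "(x, y) \<in> {(u, v). 0 < k u v}\<^sup>*"
    using assms(1) by (auto simp: irreducible_rates_def)
  then have "y \<in> S"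
  proof (induction rule: rtrancl_induct)
    case base
    then show ?case using assms(2) by simp
  next
    case (step u v)
    then show ?case using no by auto
  qed
  then show False using assms(3) by simp
qed

lemma sum_antisym_eq_0:
  fixes j :: "'a \<Rightarrow> 'a \<Rightarrow> real"
  assumes "\<And>x y. j x y = - j y x"
  shows "(\<Sum>x\<in>S. \<Sum>y\<in>S. j x y) = 0"
proof -
  have "(\<Sum>x\<in>S. \<Sum>y\<in>S. j x y) = (\<Sum>x\<in>S. \<Sum>y\<in>S. - j y x)"
    by (intro sum.cong refl assms)
  also have "\<dots> = - (\<Sum>y\<in>S. \<Sum>x\<in>S. j y x)"
    by (subst sum.swap) (simp add: sum_negf)
  finally show ?thesis by simp
qed

text \<open>Adding up the zero divergences over \<open>S\<close>, the pairs inside \<open>S\<close>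
  cancel by antisymmetry and only the pairs leaving \<open>S\<close> remain.\<close>

lemma flux_through_cut_eq_0:
  fixes j :: "'v::finite \<Rightarrow> 'v \<Rightarrow> real"
  assumes anti: "\<And>x y. j x y = - j y x" and div0: "\<And>x. (\<Sum>y\<in>UNIV. j x y) = 0"
  shows "(\<Sum>x\<in>S. \<Sum>y\<in>- S. j x y) = 0"
proof -
  have "(\<Sum>y\<in>S. j x y) + (\<Sum>y\<in>- S. j x y) = 0" for x
    using div0[of x] sum.union_disjoint[of S "- S" "j x"] by simp
  then have "(\<Sum>x\<in>S. (\<Sum>y\<in>S. j x y) + (\<Sum>y\<in>- S. j x y)) = 0"
    by simp
  then show ?thesis
    using sum_antisym_eq_0[of j S, OF anti] by (simp add: sum.distrib)
qed

section \<open>Reversible rates: oscillation bound and Poisson equation\<close>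

locale reversible_rates =
  fixes k :: "'v::finite \<Rightarrow> 'v \<Rightarrow> real" and \<rho> :: "'v \<Rightarrow> real"
  assumes k_nonneg: "0 \<le> k x y"
    and irreducible: "irreducible_rates k"
    and \<rho>_pos: "0 < \<rho> x"
    and \<rho>_sum: "(\<Sum>x\<in>UNIV. \<rho> x) = 1"
    and balance: "detailed_balance k \<rho>"
begin

text \<open>Antisymmetry of \<open>a\<close> is asked only where the rate is positive, because
  \<open>w\<close> is antisymmetric only on edges. At any other pair, detailed balance and
  positivity of \<open>\<rho>\<close> make both rates vanish.\<close>

lemma current_antisym:
  assumes "\<And>x y. 0 < k x y \<Longrightarrow> a x y = - a y x"
  shows "\<rho> x * (k x y * a x y) = - (\<rho> y * (k y x * a y x))"
proof -
  have db: "\<rho> x * k x y = \<rho> y * k y x"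
    using balance unfolding detailed_balance_def by (metis mult.commute)
  show ?thesis
  proof (cases "0 < k x y")
    case True
    have "\<rho> x * (k x y * a x y) = (\<rho> x * k x y) * a x y"
      by simp
    also have "\<dots> = (\<rho> y * k y x) * - a y x"
      using db assms[OF True] by simp
    finally show ?thesis by simp
  next
    case False
    then have "k x y = 0"
      using k_nonneg[of x y] by simp
    moreover from this have "k y x = 0"
      using db \<rho>_pos[of y] by simp
    ultimately show ?thesis by simp
  qed
qed

text \<open>A drop of \<open>f\<close> by more than \<open>M\<close> across the whole cut outweighs
  \<open>a\<close>, so each current with positive rate from \<open>S\<close> to its complement is
  negative, against zero flux. The rates matter only through the sign of the currents, which is why
  no rate enters the bound.\<close>

lemma no_gap:
  assumes anti: "\<And>x y. 0 < k x y \<Longrightarrow> a x y = - a y x"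
    and bound: "\<And>x y. 0 < k x y \<Longrightarrow> \<bar>a x y\<bar> \<le> M"
    and eq: "\<And>x. (\<Sum>y\<in>UNIV. k x y * (f y - f x + a x y)) = 0"
    and S: "x0 \<in> S" "y0 \<notin> S"
  shows "\<exists>x\<in>S. \<exists>y\<in>- S. f x - M \<le> f y"
proof (rule ccontr)
  assume "\<not> ?thesis"
  then have gap: "f y < f x - M" if "x \<in> S" "y \<in> - S" for x y
    using that by (meson not_less)
  define j where "j x y = \<rho> x * (k x y * (f y - f x + a x y))" for x y
  have "j x y = - j y x" for x y
    unfolding j_def by (rule current_antisym) (simp add: anti)
  moreover have "(\<Sum>y\<in>UNIV. j x y) = 0" for x
    using eq[of x] by (simp add: j_def flip: sum_distrib_left)
  ultimately have flux: "(\<Sum>x\<in>S. \<Sum>y\<in>- S. j x y) = 0"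
    by (rule flux_through_cut_eq_0)
  have neg: "j x y < 0" if "x \<in> S" "y \<in> - S" "0 < k x y" for x y
  proof -
    have "f y - f x + a x y < 0"
      using gap[of x y] bound[of x y] that by linarith
    then show ?thesis
      using that(3) \<rho>_pos[of x] by (simp add: j_def mult_pos_neg)
  qed
  have nonpos: "j x y \<le> 0" if "x \<in> S" "y \<in> - S" for x y
    using neg[OF that] k_nonneg[of x y] by (cases "k x y = 0") (auto simp: j_def)
  \<comment> \<open>Irreducibility makes the total strictly negative: at least one current across
    the cut is nonzero.\<close>
  obtain u v where uv: "u \<in> S" "v \<in> - S" "0 < k u v"
    using irreducible_rates_cut[OF irreducible S] by blast
  have "(\<Sum>y\<in>- S. j u y) < 0"
    using sum_strict_mono_ex1[of "- S" "j u" "\<lambda>_. 0"] nonpos neg[OF uv] uv by fastforce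
  moreover have "(\<Sum>y\<in>- S. j x y) \<le> 0" if "x \<in> S" for x
    by (rule sum_nonpos) (simp add: nonpos that)
  ultimately have "(\<Sum>x\<in>S. \<Sum>y\<in>- S. j x y) < 0"
    using sum_strict_mono_ex1[of S "\<lambda>x. \<Sum>y\<in>- S. j x y" "\<lambda>_. 0"] uv(1) by fastforce
  then show False using flux by simp
qed

lemma oscillation_le:
  assumes anti: "\<And>x y. 0 < k x y \<Longrightarrow> a x y = - a y x"
    and bound: "\<And>x y. 0 < k x y \<Longrightarrow> \<bar>a x y\<bar> \<le> M"
    and M: "0 \<le> M"
    and eq: "\<And>x. (\<Sum>y\<in>UNIV. k x y * (f y - f x + a x y)) = 0"
  shows "f x - f y \<le> of_nat CARD('v) * M"
proof -
  define S where "S n = {z. f x - of_nat n * M \<le> f z}" for n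
  have x: "x \<in> S n" for n
    using M by (simp add: S_def)
  \<comment> \<open>Each lowering of the level by \<open>M\<close> captures a new state until all are captured.\<close>
  have "S n = UNIV \<or> n < card (S n)" for n
  proof (induction n)
    case 0
    then show ?case using x[of 0] by (auto simp: card_gt_0_iff)
  next
    case (Suc n)
    have sub: "S n \<subseteq> S (Suc n)"
      using M by (auto simp: S_def algebra_simps)
    show ?case
    proof (cases "S n = UNIV")
      case True
      then show ?thesis using sub by auto
    next
      case False
      then obtain y0 where "y0 \<notin> S n" by auto
      from no_gap[OF anti bound eq x this] obtain u v
        where uv: "u \<in> S n" "v \<notin> S n" "f u - M \<le> f v" by auto
      then have "v \<in> S (Suc n)"
        by (simp add: S_def algebra_simps)
      with sub uv have "S n \<subset> S (Suc n)" by auto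
      then have "card (S n) < card (S (Suc n))"
        by (simp add: psubset_card_mono)
      then show ?thesis using Suc False by simp
    qed
  qed
  \<comment> \<open>The other alternative would give a set with more elements than there are
    states.\<close>
  from this[of "CARD('v)"] have "S CARD('v) = UNIV"
    using card_mono[of UNIV "S CARD('v)"] by auto
  then have "y \<in> S CARD('v)" by simp
  then show ?thesis by (simp add: S_def)
qed

lemma mean_generator: "mean \<rho> (generator k f) = 0"
proof -
  have "mean \<rho> (generator k f) = (\<Sum>x\<in>UNIV. \<Sum>y\<in>UNIV. \<rho> x * (k x y * (f y - f x)))"
    by (simp add: mean_def generator_def sum_distrib_left mult.commute[of _ "\<rho> _"])
  also have "\<dots> = 0"
    by (rule sum_antisym_eq_0) (rule current_antisym, simp)
  finally show ?thesis .
qed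

lemma mean_const: "mean \<rho> (\<lambda>_. c) = c"
  using \<rho>_sum by (simp add: mean_def flip: sum_distrib_left)

text \<open>The oscillation bound with \<open>a = 0\<close> and \<open>M = 0\<close> makes
  \<open>f\<close> constant, and a constant equals its mean.\<close>

lemma generator_eq_0_imp_0:
  assumes gen: "\<And>x. generator k f x = 0" and mean0: "mean \<rho> f = 0"
  shows "f x = 0"
proof -
  have "f y - f z \<le> of_nat CARD('v) * 0" for y z
    by (rule oscillation_le[where a = "\<lambda>_ _. 0"]) (use gen in \<open>auto simp: generator_def\<close>)
  then have "f = (\<lambda>_. f x)"
    by (intro ext antisym) (auto simp: algebra_simps)
  then have "mean \<rho> f = f x"
    using mean_const[of "f x"] by simp
  then show ?thesis using mean0 by simp
qed

lemma poisson_solvable: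
  assumes g: "mean \<rho> g = 0"
  shows "\<exists>f. (\<forall>x. generator k f x = g x) \<and> mean \<rho> f = 0"
proof -
  \<comment> \<open>The added mean makes the generator injective, and it vanishes on solutions of
    \<open>T f = g\<close> because the range of the generator has mean zero.\<close>
  define T :: "real^'v \<Rightarrow> real^'v" where
    "T f = (\<chi> x. generator k (($) f) x + mean \<rho> (($) f))" for f
  have lin: "linear T"
    by (rule linearI)
      (simp_all add: T_def vec_eq_iff generator_def mean_def algebra_simps sum.distrib
        sum_subtractf sum_distrib_left)
  \<comment> \<open>Used twice: with \<open>h = 0\<close> for injectivity of \<open>T\<close>, and
    with \<open>h = g\<close> to read off the solution.\<close>
  have split: "mean \<rho> (($) f) = 0 \<and> (\<forall>x. generator k (($) f) x = h x)"
    if h: "mean \<rho> h = 0" and T: "\<And>x. T f $ x = h x" for f h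
  proof -
    have "h x = generator k (($) f) x + mean \<rho> (($) f)" for x
      using T[of x] by (simp add: T_def)
    moreover from this have "mean \<rho> h = mean \<rho> (generator k (($) f)) + mean \<rho> (\<lambda>_. mean \<rho> (($) f))"
      by (simp add: mean_def[of \<rho> h] mean_def[of \<rho> "generator k (($) f)"]
          mean_def[of \<rho> "\<lambda>_. mean \<rho> (($) f)"] distrib_right sum.distrib)
    ultimately show ?thesis
      using h by (simp add: mean_generator mean_const)
  qed
  have "f = 0" if "T f = 0" for f
    using split[of "\<lambda>_. 0" f] generator_eq_0_imp_0[of "($) f"] that
    by (simp add: mean_const vec_eq_iff)
  then have "inj T"
    using lin by (simp add: linear_injective_0)
  then have "surj T"
    using lin by (simp add: linear_injective_imp_surjective)
  then obtain f where "T f = (\<chi> x. g x)"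
    by (metis surjD)
  then show ?thesis
    using split[OF g, of f] by auto
qed

end

section \<open>Equilibrium weights\<close>

lemma rho_eq_pos: "0 < rho_eq \<beta> E x"
  by (simp add: rho_eq_def sum_pos)

lemma sum_rho_eq: "(\<Sum>x\<in>UNIV. rho_eq \<beta> E x) = 1"
proof -
  have "(\<Sum>y\<in>UNIV. exp (- \<beta> * E y)) > 0"
    by (simp add: sum_pos)
  then show ?thesis
    by (simp add: rho_eq_def flip: sum_divide_distrib)
qed

text \<open>The partition function is at least its single term at \<open>z\<close>; later
  \<open>z\<close> is a state of minimal energy.\<close>

lemma rho_eq_le_exp: "rho_eq \<beta> E x \<le> exp (- (\<beta> * (E x - E z)))"
proof -
  have "exp (- \<beta> * E z) \<le> (\<Sum>y\<in>UNIV. exp (- \<beta> * E y))"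
    by (rule member_le_sum) auto
  then have "rho_eq \<beta> E x \<le> exp (- \<beta> * E x) / exp (- \<beta> * E z)"
    unfolding rho_eq_def by (intro divide_left_mono) (auto intro!: mult_pos_pos sum_pos)
  also have "\<dots> = exp (- (\<beta> * (E x - E z)))"
    by (simp add: algebra_simps flip: exp_diff)
  finally show ?thesis .
qed

text \<open>The Boltzmann weight of an excited state absorbs the factor \<open>\<beta>\<close>, even
  as \<open>\<beta>\<close> tends to infinity.\<close>

lemma scaled_energy_rho_eq_le_1:
  assumes "0 < \<beta>" "E z \<le> E x"
  shows "\<beta> * (E x - E z) * rho_eq \<beta> E x \<le> 1"
proof -
  let ?t = "\<beta> * (E x - E z)"
  have "0 \<le> ?t" using assms by simp
  then have "?t * rho_eq \<beta> E x \<le> ?t * exp (- ?t)"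
    by (intro mult_left_mono rho_eq_le_exp)
  also have "\<dots> \<le> exp ?t * exp (- ?t)"
  proof (rule mult_right_mono)
    show "?t \<le> exp ?t"
      using exp_ge_add_one_self[of ?t] by linarith
  qed simp
  also have "\<dots> = 1"
    by (simp flip: exp_add)
  finally show ?thesis .
qed

lemma abs_le_sum_abs: "\<bar>f x\<bar> \<le> (\<Sum>y\<in>UNIV. \<bar>f y\<bar>)" for f :: "'v::finite \<Rightarrow> real"
  by (rule member_le_sum) auto

lemma abs_mean_rho_eq_le: "(\<And>x. \<bar>f x\<bar> \<le> B) \<Longrightarrow> \<bar>mean (rho_eq \<beta> E) f\<bar> \<le> B"
proof -
  assume f: "\<And>x. \<bar>f x\<bar> \<le> B"
  have "\<bar>mean (rho_eq \<beta> E) f\<bar> \<le> (\<Sum>x\<in>UNIV. \<bar>f x * rho_eq \<beta> E x\<bar>)"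
    unfolding mean_def by (rule sum_abs)
  also have "\<dots> \<le> (\<Sum>x\<in>UNIV. B * rho_eq \<beta> E x)"
    using f by (intro sum_mono) (simp add: abs_mult less_imp_le rho_eq_pos mult_right_mono)
  also have "\<dots> = B"
    by (simp add: sum_rho_eq flip: sum_distrib_left)
  finally show ?thesis .
qed

section \<open>Temperature-independent bounds for \<open>W\<close> and its energy
  correlation\<close>

lemma W_ML_poisson_solution:
  assumes "reversible_rates k (rho_eq \<beta> E)"
    and anti: "\<And>x y. 0 < k x y \<Longrightarrow> w x y = - w y x"
  shows "poisson_solution \<beta> E k w \<epsilon> (W_ML \<beta> E k w \<epsilon>)"
proof -
  interpret reversible_rates k "rho_eq \<beta> E" by fact
  let ?g = "\<lambda>x. - \<epsilon> * (\<Sum>y\<in>UNIV. k x y * w x y)"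
  \<comment> \<open>The solvability condition: the source has mean zero because its weighted terms
    cancel in pairs.\<close>
  have "mean (rho_eq \<beta> E) ?g = - \<epsilon> * (\<Sum>x\<in>UNIV. \<Sum>y\<in>UNIV. rho_eq \<beta> E x * (k x y * w x y))"
    by (simp add: mean_def sum_distrib_left sum_negf algebra_simps)
  also have "(\<Sum>x\<in>UNIV. \<Sum>y\<in>UNIV. rho_eq \<beta> E x * (k x y * w x y)) = 0"
    by (rule sum_antisym_eq_0) (rule current_antisym[OF anti])
  finally have "\<exists>W. poisson_solution \<beta> E k w \<epsilon> W"
    using poisson_solvable[of ?g] by (simp add: poisson_solution_def)
  \<comment> \<open>Uniqueness gives the definite description in \<open>W_ML\<close> its
    meaning.\<close>
  moreover have "W = W'"
    if "poisson_solution \<beta> E k w \<epsilon> W" "poisson_solution \<beta> E k w \<epsilon> W'" for W W'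
  proof
    fix x
    have "W x - W' x = 0"
    proof (rule generator_eq_0_imp_0[of "\<lambda>x. W x - W' x"])
      show "generator k (\<lambda>x. W x - W' x) y = 0" for y
      proof -
        have "generator k (\<lambda>x. W x - W' x) y = generator k W y - generator k W' y"
          unfolding generator_def sum_subtractf[symmetric]
          by (rule sum.cong) (simp_all add: algebra_simps)
        then show ?thesis using that by (simp add: poisson_solution_def)
      qed
      show "mean (rho_eq \<beta> E) (\<lambda>x. W x - W' x) = 0"
        using that by (simp add: poisson_solution_def mean_def left_diff_distrib sum_subtractf)
    qed
    then show "W x = W' x" by simp
  qed
  ultimately show ?thesis
    unfolding W_ML_def by (metis (no_types, lifting) theI)
qed

lemma abs_W_ML_le:
  fixes k :: "'v::finite \<Rightarrow> 'v \<Rightarrow> real"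
  assumes rev: "reversible_rates k (rho_eq \<beta> E)"
    and anti: "\<And>x y. 0 < k x y \<Longrightarrow> w x y = - w y x"
    and bound: "\<And>x y. \<bar>w x y\<bar> \<le> A"
  shows "\<bar>W_ML \<beta> E k w \<epsilon> x\<bar> \<le> of_nat CARD('v) * (\<bar>\<epsilon>\<bar> * A)"
proof -
  interpret reversible_rates k "rho_eq \<beta> E" by fact
  define W where "W = W_ML \<beta> E k w \<epsilon>"
  have gen: "generator k W x = - \<epsilon> * (\<Sum>y\<in>UNIV. k x y * w x y)"
    and mean0: "mean (rho_eq \<beta> E) W = 0" for x
    using W_ML_poisson_solution[OF rev anti] by (auto simp: W_def poisson_solution_def)
  have osc: "W x - W y \<le> of_nat CARD('v) * (\<bar>\<epsilon>\<bar> * A)" for x y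
  proof (rule oscillation_le[where a = "\<lambda>x y. \<epsilon> * w x y"])
    show "(\<Sum>y\<in>UNIV. k x y * (W y - W x + \<epsilon> * w x y)) = 0" for x
      using gen[of x]
      by (simp add: generator_def distrib_left sum.distrib sum_distrib_left mult.left_commute sum_negf)
    show "\<epsilon> * w x y = - (\<epsilon> * w y x)" if "0 < k x y" for x y
      using anti[OF that] by simp
    show "\<bar>\<epsilon> * w x y\<bar> \<le> \<bar>\<epsilon>\<bar> * A" for x y
      using bound[of x y] by (simp add: abs_mult mult_left_mono)
    show "0 \<le> \<bar>\<epsilon>\<bar> * A"
      \<comment> \<open>Any pair of states serves: \<open>A\<close> bounds an absolute value, hence
        is nonnegative.\<close>
      using bound[of undefined undefined] by simp
  qed
  \<comment> \<open>As \<open>W\<close> has mean zero, its value at \<open>x\<close> is an average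
    of differences, so the oscillation bound carries over to \<open>W\<close> itself.\<close>
  have "W x = mean (rho_eq \<beta> E) (\<lambda>y. W x - W y)"
    using mean0 mean_const[of "W x"] by (simp add: mean_def left_diff_distrib sum_subtractf)
  also have "\<bar>\<dots>\<bar> \<le> of_nat CARD('v) * (\<bar>\<epsilon>\<bar> * A)"
    by (rule abs_mean_rho_eq_le) (use osc in \<open>simp add: abs_le_iff\<close>)
  finally show ?thesis by (simp add: W_def)
qed

text \<open>Since \<open>W\<close> has mean zero, energies may be measured from the minimum
  \<open>E z\<close>. Each state then contributes at most \<open>B\<close>, as
  \<open>\<beta> * (E x - E z) * rho_eq \<beta> E x\<close> lies between 0 and 1.\<close>

lemma scaled_abs_mean_energy_mult_le:
  fixes E :: "'v::finite \<Rightarrow> real"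
  assumes \<beta>: "0 < \<beta>" and mean0: "mean (rho_eq \<beta> E) W = 0" and W: "\<And>x. \<bar>W x\<bar> \<le> B"
  shows "\<bar>\<beta> * mean (rho_eq \<beta> E) (\<lambda>x. E x * W x)\<bar> \<le> of_nat CARD('v) * B"
proof -
  obtain z where z: "\<And>x. E z \<le> E x"
    using ex_min_if_finite[of "range E"] by (auto simp: not_less)
  have "\<beta> * mean (rho_eq \<beta> E) (\<lambda>x. E x * W x)
      = \<beta> * mean (rho_eq \<beta> E) (\<lambda>x. E x * W x) - \<beta> * E z * mean (rho_eq \<beta> E) W"
    using mean0 by simp
  also have "\<dots> = (\<Sum>x\<in>UNIV. (\<beta> * (E x - E z) * rho_eq \<beta> E x) * W x)"
    unfolding mean_def sum_distrib_left sum_subtractf[symmetric]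
    by (rule sum.cong) (simp_all add: algebra_simps)
  also have "\<bar>\<dots>\<bar> \<le> (\<Sum>x\<in>(UNIV :: 'v set). B)"
  proof (rule order_trans[OF sum_abs], rule sum_mono)
    fix x
    have "0 \<le> \<beta> * (E x - E z) * rho_eq \<beta> E x"
      using \<beta> z[of x] by (simp add: less_imp_le[OF rho_eq_pos])
    then show "\<bar>\<beta> * (E x - E z) * rho_eq \<beta> E x * W x\<bar> \<le> B"
      using mult_mono[OF scaled_energy_rho_eq_le_1[OF \<beta> z[of x]] W[of x]]
      by (simp only: abs_mult[of _ "W x"] abs_of_nonneg) simp
  qed
  finally show ?thesis by simp
qed

section \<open>The uniform bound on the quasipotential\<close>

theorem propositionV1:
  fixes E :: "'v::finite \<Rightarrow> real"
    and w :: "'v \<Rightarrow> 'v \<Rightarrow> real"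
    and Edges :: "'v set set"
    and k :: "real \<Rightarrow> 'v \<Rightarrow> 'v \<Rightarrow> real"
    and \<epsilon> :: real
  assumes graph: "connected_graph Edges"
    and antisym: "\<And>x y. {x, y} \<in> Edges \<Longrightarrow> w x y = - w y x"
    and nonneg: "\<And>\<beta> x y. 0 < \<beta> \<Longrightarrow> 0 \<le> k \<beta> x y"
    and edges: "\<And>\<beta> x y. 0 < \<beta> \<Longrightarrow> {x, y} \<in> Edges \<longleftrightarrow> 0 < k \<beta> x y"
    and irreducible: "\<And>\<beta>. 0 < \<beta> \<Longrightarrow> irreducible_rates (k \<beta>)"
    and balance: "\<And>\<beta>. 0 < \<beta> \<Longrightarrow> detailed_balance (k \<beta>) (rho_eq \<beta> E)"
  shows "\<exists>K. \<forall>\<beta>>0. \<forall>x. \<bar>V_ML \<beta> E (k \<beta>) w \<epsilon> x\<bar> \<le> K"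
proof -
  define A where "A = (\<Sum>x\<in>UNIV. \<Sum>y\<in>UNIV. \<bar>w x y\<bar>)"
  define B where "B = of_nat CARD('v) * (\<bar>\<epsilon>\<bar> * A)"
  define C where "C = (\<Sum>x\<in>UNIV. \<bar>E x\<bar>)"
  have A: "\<bar>w x y\<bar> \<le> A" for x y
    using abs_le_sum_abs[of "w x" y] abs_le_sum_abs[of "\<lambda>x. \<Sum>y\<in>UNIV. \<bar>w x y\<bar>" x]
    by (simp add: A_def)
  \<comment> \<open>The summands bound, in order, the energy at \<open>x\<close>, its equilibrium
    mean, the McLennan correction to that mean, and \<open>W x\<close>. None of \<open>A\<close>,
    \<open>B\<close>, \<open>C\<close> involves \<open>\<beta>\<close> or the rates.\<close>
  have "\<bar>V_ML \<beta> E (k \<beta>) w \<epsilon> x\<bar> \<le> C + C + of_nat CARD('v) * B + B" if \<beta>: "0 < \<beta>" for \<beta> x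
  proof -
    have rev: "reversible_rates (k \<beta>) (rho_eq \<beta> E)"
      using nonneg irreducible balance \<beta>
      by unfold_locales (auto simp: rho_eq_pos sum_rho_eq)
    have anti: "w x y = - w y x" if "0 < k \<beta> x y" for x y
      using antisym edges \<beta> that by blast
    define W where "W = W_ML \<beta> E (k \<beta>) w \<epsilon>"
    have W: "\<bar>W x\<bar> \<le> B" for x
      unfolding W_def B_def by (rule abs_W_ML_le[OF rev anti A])
    have mean0: "mean (rho_eq \<beta> E) W = 0"
      using W_ML_poisson_solution[OF rev anti] by (simp add: W_def poisson_solution_def)
    have "mean (rho_ML \<beta> E (k \<beta>) w \<epsilon>) E
        = mean (rho_eq \<beta> E) E - \<beta> * mean (rho_eq \<beta> E) (\<lambda>x. E x * W x)"
      unfolding mean_def rho_ML_def W_def[symmetric] sum_distrib_left sum_subtractf[symmetric]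
      by (rule sum.cong) (simp_all add: algebra_simps)
    moreover have "\<bar>\<beta> * mean (rho_eq \<beta> E) (\<lambda>x. E x * W x)\<bar> \<le> of_nat CARD('v) * B"
      by (rule scaled_abs_mean_energy_mult_le[OF \<beta> mean0 W])
    moreover have "\<bar>mean (rho_eq \<beta> E) E\<bar> \<le> C" "\<bar>E x\<bar> \<le> C"
      unfolding C_def by (auto intro!: abs_mean_rho_eq_le abs_le_sum_abs)
    ultimately show ?thesis
      using W[of x] unfolding V_ML_def W_def[symmetric] by linarith
  qed
  then show ?thesis by blast
qed

end
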